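(* Let $A$ and $B$ be alphabets and let $f: B^+ \to A^+$ be a homomorphism between the free semigroups $B^+$ and $A^+$. Then the following are equivalent: (a) $f^{*}: \mathcal P(A^+) \to \mathcal P(B^+)$ is a semigroup homomorphism; (b) $f^*\circ i: A^+ \to \mathcal P(B^+)$ is a semigroup homomorphism; (c) $f$ is an lp-morphism.
   Context: An alphabet is a finite set, whose elements are called letters; $A^+$ is the free semigroup of non-empty words over $A$. For a semigroup $S$, the set $\mathcal P(S)$ of all subsets of $S$ is a semigroup under pointwise multiplication $Q_1 \cdot Q_2 = \{s_1 s_2 \mid s_1 \in Q_1, s_2 \in Q_2\}$. The map $f^*: \mathcal P(A^+) \to \mathcal P(B^+)$ is the inverse image map $Q \mapsto f^{-1}(Q)$, and $i: A^+ \to \mathcal P(A^+)$ is $w \mapsto \{w\}$. A homomorphism $f: B^+ \to A^+$ is length-preserving, or an lp-morphism, if it maps letters to letters. *)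

theory Defs
  imports Main "HOL-Library.FuncSet"
begin

text \<open>
  Semigroups are given by an explicit carrier and an operation. The group and monoid records of
  HOL-Algebra carry a unit element, which the semigroups used here do not have;
  \<open>semigroup_hom\<close> is otherwise the same notion as \<open>hom\<close> in HOL-Algebra.
\<close>

definition is_semigroup :: "'s set \<Rightarrow> ('s \<Rightarrow> 's \<Rightarrow> 's) \<Rightarrow> bool" where
  "is_semigroup S m \<longleftrightarrow>
    (\<forall>x\<in>S. \<forall>y\<in>S. m x y \<in> S) \<and>
    (\<forall>x\<in>S. \<forall>y\<in>S. \<forall>z\<in>S. m (m x y) z = m x (m y z))"

definition semigroup_hom ::
  "'s set \<Rightarrow> ('s \<Rightarrow> 's \<Rightarrow> 's) \<Rightarrow> 't set \<Rightarrow> ('t \<Rightarrow> 't \<Rightarrow> 't) \<Rightarrow> ('s \<Rightarrow> 't) \<Rightarrow> bool" where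
  "semigroup_hom S mS T mT h \<longleftrightarrow>
    h \<in> S \<rightarrow> T \<and> (\<forall>x\<in>S. \<forall>y\<in>S. h (mS x y) = mT (h x) (h y))"

text \<open>The free semigroup \<open>A\<^sup>+\<close> has carrier \<open>plus_words A\<close> and operation \<open>(@)\<close>.\<close>

definition plus_words :: "'a set \<Rightarrow> 'a list set" where
  "plus_words A = lists A - {[]}"

text \<open>The power semigroup \<open>\<P>(S)\<close> has carrier \<open>Pow S\<close> (the empty set included).\<close>

definition set_prod :: "('s \<Rightarrow> 's \<Rightarrow> 's) \<Rightarrow> 's set \<Rightarrow> 's set \<Rightarrow> 's set" where
  "set_prod m Q1 Q2 = {m s1 s2 | s1 s2. s1 \<in> Q1 \<and> s2 \<in> Q2}"

text \<open>
  A map \<open>f\<close> from \<open>B\<^sup>+\<close> is represented by a total function on lists. Its inverse image map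
  \<open>f\<^sup>*\<close> must therefore discard the lists outside \<open>B\<^sup>+\<close>, where the values of \<open>f\<close> are meaningless.
\<close>

definition inv_image_map :: "'b set \<Rightarrow> ('b list \<Rightarrow> 'a list) \<Rightarrow> 'a list set \<Rightarrow> 'b list set" where
  "inv_image_map B f Q = {w \<in> plus_words B. f w \<in> Q}"

definition lp_morphism :: "'b set \<Rightarrow> 'a set \<Rightarrow> ('b list \<Rightarrow> 'a list) \<Rightarrow> bool" where
  "lp_morphism B A f \<longleftrightarrow>
    semigroup_hom (plus_words B) (@) (plus_words A) (@) f \<and>
    (\<forall>b\<in>B. \<exists>a\<in>A. f [b] = [a])"

lemma is_semigroup_plus_words: "is_semigroup (plus_words A) (@)"
  by (auto simp: is_semigroup_def plus_words_def)

lemma is_semigroup_Pow: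
  assumes "is_semigroup S m"
  shows "is_semigroup (Pow S) (set_prod m)"
proof -
  have closed: "m x y \<in> S" if "x \<in> S" "y \<in> S" for x y
    using assms that by (auto simp: is_semigroup_def)
  have assoc: "m (m x y) z = m x (m y z)" if "x \<in> S" "y \<in> S" "z \<in> S" for x y z
    using assms that by (auto simp: is_semigroup_def)
  have "set_prod m (set_prod m X Y) Z = set_prod m X (set_prod m Y Z)"
    if "X \<subseteq> S" "Y \<subseteq> S" "Z \<subseteq> S" for X Y Z
  proof (intro equalityI subsetI)
    fix w assume "w \<in> set_prod m (set_prod m X Y) Z"
    then obtain x y z where "x \<in> X" "y \<in> Y" "z \<in> Z" "w = m (m x y) z"
      unfolding set_prod_def by blast
    moreover from this have "w = m x (m y z)" using assoc that by (metis subsetD)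
    ultimately show "w \<in> set_prod m X (set_prod m Y Z)" unfolding set_prod_def by blast
  next
    fix w assume "w \<in> set_prod m X (set_prod m Y Z)"
    then obtain x y z where "x \<in> X" "y \<in> Y" "z \<in> Z" "w = m x (m y z)"
      unfolding set_prod_def by blast
    moreover from this have "w = m (m x y) z" using assoc that by (metis subsetD)
    ultimately show "w \<in> set_prod m (set_prod m X Y) Z" unfolding set_prod_def by blast
  qed
  moreover have "set_prod m X Y \<subseteq> S" if "X \<subseteq> S" "Y \<subseteq> S" for X Y
    using closed that by (auto simp: set_prod_def)
  ultimately show ?thesis by (simp add: is_semigroup_def)
qed

end

theory Submission
  imports Defs
begin

text \<open>
  If the inverse image is multiplicative on singletons and \<open>f [b] = x @ y\<close> with both factors
  non-empty, then the one-letter word \<open>[b]\<close> is a product of two non-empty words, which is absurd.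
  Conversely, an lp-morphism preserves length, so a factorisation of \<open>f w\<close> lifts to the
  factorisation of \<open>w\<close> at the same position.
\<close>

lemma append_in_plus_words: "u \<in> plus_words B \<Longrightarrow> v \<in> plus_words B \<Longrightarrow> u @ v \<in> plus_words B"
  by (auto simp: plus_words_def)

lemma semigroup_hom_closed: "semigroup_hom S mS T mT h \<Longrightarrow> x \<in> S \<Longrightarrow> h x \<in> T"
  by (auto simp: semigroup_hom_def)

lemma semigroup_hom_mult:
  "semigroup_hom S mS T mT h \<Longrightarrow> x \<in> S \<Longrightarrow> y \<in> S \<Longrightarrow> h (mS x y) = mT (h x) (h y)"
  by (simp add: semigroup_hom_def)

lemma semigroup_hom_comp:
  assumes "semigroup_hom S mS T mT g" and "semigroup_hom T mT U mU h"
  shows "semigroup_hom S mS U mU (h \<circ> g)"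
  using assms by (auto simp: semigroup_hom_def Pi_iff)

text \<open>This is the map \<open>i\<close>; composing it with \<open>inv_image_map B f\<close>
  yields the passage from (a) to (b).\<close>

lemma semigroup_hom_singleton: "semigroup_hom S m (Pow S) (set_prod m) (\<lambda>w. {w})"
  by (auto simp: semigroup_hom_def set_prod_def)

text \<open>Splitting off the first letter gives \<open>f (b # w) = f [b] @ f w\<close>, and
  \<open>f [b]\<close> contributes exactly one letter. The value \<open>f []\<close> is unspecified,
  so the induction starts at one-letter words.\<close>

lemma lp_morphism_length:
  assumes "lp_morphism B A f" and "w \<in> plus_words B"
  shows "length (f w) = length w"
proof -
  have hom: "semigroup_hom (plus_words B) (@) (plus_words A) (@) f"
    and letter: "\<And>b. b \<in> B \<Longrightarrow> length (f [b]) = 1"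
    using assms(1) by (auto simp: lp_morphism_def)
  from assms(2) have "w \<noteq> []" and "set w \<subseteq> B"
    by (auto simp: plus_words_def)
  then show ?thesis
  proof (induction w rule: list_nonempty_induct)
    case (single b)
    then show ?case using letter by simp
  next
    case (cons b w)
    then have "[b] \<in> plus_words B" and "w \<in> plus_words B"
      by (auto simp: plus_words_def)
    from semigroup_hom_mult[OF hom this] show ?case
      using cons letter by simp
  qed
qed

text \<open>Only the inclusion from left to right uses preservation of length; the other one holds
  for every homomorphism.\<close>

lemma lp_morphism_inv_image_hom:
  assumes lp: "lp_morphism B A f"
  shows "semigroup_hom (Pow (plus_words A)) (set_prod (@)) (Pow (plus_words B)) (set_prod (@))
    (inv_image_map B f)"
proof -
  have hom: "semigroup_hom (plus_words B) (@) (plus_words A) (@) f"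
    using lp by (simp add: lp_morphism_def)
  have "inv_image_map B f (set_prod (@) P Q)
      = set_prod (@) (inv_image_map B f P) (inv_image_map B f Q)"
    if "P \<subseteq> plus_words A" and "Q \<subseteq> plus_words A" for P Q
  proof (intro equalityI subsetI)
    fix w assume "w \<in> inv_image_map B f (set_prod (@) P Q)"
    then obtain p q where w: "w \<in> plus_words B" and fw: "f w = p @ q" and pq: "p \<in> P" "q \<in> Q"
      by (auto simp: inv_image_map_def set_prod_def)
    \<comment> \<open>Since \<open>p\<close> and \<open>q\<close> are non-empty, the cut at
      \<open>length p\<close> falls strictly inside \<open>w\<close>, so both pieces lie in
      \<open>plus_words B\<close>.\<close>
    have ne: "p \<noteq> []" "q \<noteq> []"
      using pq that by (auto simp: plus_words_def)
    define u v where "u = take (length p) w" and "v = drop (length p) w"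
    have len: "length w = length p + length q"
      using lp_morphism_length[OF lp w] fw by simp
    have uv: "u \<in> plus_words B" "v \<in> plus_words B"
      using w ne len by (auto simp: u_def v_def plus_words_def dest: in_set_takeD in_set_dropD)
    have "f u @ f v = p @ q"
      using semigroup_hom_mult[OF hom uv] fw by (simp add: u_def v_def)
    moreover have "length (f u) = length p"
      using lp_morphism_length[OF lp uv(1)] len by (simp add: u_def)
    \<comment> \<open>Two factorisations of the same word whose left factors have equal length
      coincide.\<close>
    ultimately have "f u = p" "f v = q"
      by simp_all
    then have "u \<in> inv_image_map B f P" "v \<in> inv_image_map B f Q"
      using uv pq by (auto simp: inv_image_map_def)
    moreover have "w = u @ v"
      by (simp add: u_def v_def)
    ultimately show "w \<in> set_prod (@) (inv_image_map B f P) (inv_image_map B f Q)"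
      by (auto simp: set_prod_def)
  next
    fix w assume "w \<in> set_prod (@) (inv_image_map B f P) (inv_image_map B f Q)"
    then obtain u v where "w = u @ v" "u \<in> plus_words B" "v \<in> plus_words B" "f u \<in> P" "f v \<in> Q"
      by (auto simp: inv_image_map_def set_prod_def)
    then show "w \<in> inv_image_map B f (set_prod (@) P Q)"
      using semigroup_hom_mult[OF hom]
      by (auto simp: inv_image_map_def set_prod_def append_in_plus_words)
  qed
  then show ?thesis
    by (auto simp: semigroup_hom_def inv_image_map_def)
qed

lemma inv_image_singleton_hom_imp_lp_morphism:
  assumes hom: "semigroup_hom (plus_words B) (@) (plus_words A) (@) f"
    and inv_hom: "semigroup_hom (plus_words A) (@) (Pow (plus_words B)) (set_prod (@))
      (inv_image_map B f \<circ> (\<lambda>w. {w}))"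
  shows "lp_morphism B A f"
proof -
  have "\<exists>a\<in>A. f [b] = [a]" if "b \<in> B" for b
  proof -
    have b: "[b] \<in> plus_words B"
      using that by (simp add: plus_words_def)
    then have "f [b] \<in> plus_words A"
      by (rule semigroup_hom_closed[OF hom])
    then obtain a x where fb: "f [b] = a # x" and a: "a \<in> A" and x: "x \<in> lists A"
      by (cases "f [b]") (auto simp: plus_words_def)
    have "x = []"
    proof (rule ccontr)
      assume "x \<noteq> []"
      then have "[a] \<in> plus_words A" "x \<in> plus_words A"
        using a x by (auto simp: plus_words_def)
      \<comment> \<open>The word \<open>f [b]\<close> is cut after its first letter, as
        \<open>[a] @ x\<close>.\<close>
      from semigroup_hom_mult[OF inv_hom this]
      have "inv_image_map B f {a # x}
          = set_prod (@) (inv_image_map B f {[a]}) (inv_image_map B f {x})"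
        by simp
      moreover have "[b] \<in> inv_image_map B f {a # x}"
        using b fb by (simp add: inv_image_map_def)
      \<comment> \<open>Both factors are non-empty because \<open>inv_image_map\<close> keeps only
        words of \<open>plus_words B\<close>.\<close>
      ultimately obtain u v where "[b] = u @ v" "u \<noteq> []" "v \<noteq> []"
        by (auto simp: set_prod_def inv_image_map_def plus_words_def)
      then show False
        by (simp add: Cons_eq_append_conv)
    qed
    then show ?thesis
      using fb a by blast
  qed
  then show ?thesis
    using hom by (simp add: lp_morphism_def)
qed

theorem lemma3p7:
  fixes A :: "'a set" and B :: "'b set" and f :: "'b list \<Rightarrow> 'a list"
  assumes "finite A" and "finite B"
    and "semigroup_hom (plus_words B) (@) (plus_words A) (@) f"
  shows "(semigroup_hom (Pow (plus_words A)) (set_prod (@)) (Pow (plus_words B)) (set_prod (@))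
            (inv_image_map B f)
          \<longleftrightarrow> semigroup_hom (plus_words A) (@) (Pow (plus_words B)) (set_prod (@))
            (inv_image_map B f \<circ> (\<lambda>w. {w})))
       \<and> (semigroup_hom (plus_words A) (@) (Pow (plus_words B)) (set_prod (@))
            (inv_image_map B f \<circ> (\<lambda>w. {w}))
          \<longleftrightarrow> lp_morphism B A f)"
  \<comment> \<open>The three facts close the cycle: (a) implies (b), (c) implies (a), and (b)
    implies (c).\<close>
  using semigroup_hom_comp[OF semigroup_hom_singleton] lp_morphism_inv_image_hom
    inv_image_singleton_hom_imp_lp_morphism[OF assms(3)]
  by blast

end
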